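(* Let $\mu(n)=\frac{\pi\sqrt{24n-1}}{6}$. For $k=0$ or $k=1$ and every integer $n\geq 4$, \[\frac{M_k(n)}{p(n)}=\frac{1}{2}+(-1)^kE^{c}(n),\qquad\text{where}\qquad |E^{c}(n)|\leq 11578\, e^{-\frac{\mu(n)}{4}}.\]
   Context: $p(n)$ denotes the number of partitions of $n$. For a partition $\lambda$ of a positive integer, let $\omega(\lambda)$ be the number of parts equal to $1$ and let $\nu(\lambda)$ be the number of parts of $\lambda$ strictly larger than $\omega(\lambda)$. The crank of $\lambda$ is its largest part if $\omega(\lambda)=0$, and $\nu(\lambda)-\omega(\lambda)$ if $\omega(\lambda)>0$. For $n\geq 0$, $M_0(n)$ (resp. $M_1(n)$) denotes the number of partitions of $n$ with even (resp. odd) crank. *)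

theory Defs
  imports Complex_Main "HOL-Library.Multiset"
begin

definition partitions :: "nat \<Rightarrow> nat multiset set" where
  "partitions n = {L. 0 \<notin># L \<and> sum_mset L = n}"

definition p :: "nat \<Rightarrow> nat" where
  "p n = card (partitions n)"

definition omega :: "nat multiset \<Rightarrow> nat" where
  "omega L = count L 1"

definition nu :: "nat multiset \<Rightarrow> nat" where
  "nu L = size {#i \<in># L. omega L < i#}"

text \<open>Only meant for partitions of positive integers: on the empty multiset, \<open>Max\<close> is
  unspecified.\<close>

definition crank :: "nat multiset \<Rightarrow> int" where
  "crank L = (if omega L = 0 then int (Max (set_mset L)) else int (nu L) - int (omega L))"

text \<open>On \<open>int\<close>, the result of \<open>mod 2\<close> is 0 or 1 also for negative cranks, so \<open>k = 0\<close> counts the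
  even cranks and \<open>k = 1\<close> the odd ones.\<close>

definition M :: "nat \<Rightarrow> nat \<Rightarrow> nat" where
  "M k n = card {L \<in> partitions n. crank L mod 2 = int k}"

definition mu :: "nat \<Rightarrow> real" where
  "mu n = pi * sqrt (24 * real n - 1) / 6"

text \<open>The cardinalities above are those of finite sets, so \<open>card\<close> does not default to 0.\<close>

lemma finite_partitions: "finite (partitions n)"
proof -
  have "partitions n \<subseteq> mset ` {xs. set xs \<subseteq> {..n} \<and> length xs \<le> n}"
  proof
    fix L assume "L \<in> partitions n"
    then have nz: "0 \<notin># L" and s: "sum_mset L = n"
      by (auto simp: partitions_def)
    obtain xs where xs: "L = mset xs"
      by (metis ex_mset)
    have sl: "sum_list xs = n" and z: "0 \<notin> set xs"
      using s nz by (auto simp: xs sum_mset_sum_list)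
    from z have "length xs \<le> sum_list xs"
      by (induction xs) auto
    moreover have "set xs \<subseteq> {..n}"
      using sl member_le_sum_list by fastforce
    ultimately show "L \<in> mset ` {xs. set xs \<subseteq> {..n} \<and> length xs \<le> n}"
      using xs sl by auto
  qed
  then show ?thesis
    using finite_lists_length_le[of "{..n}" n] finite_subset by blast
qed

end

theory Submission
  imports Defs
    "HOL-Computational_Algebra.Formal_Power_Series"
    "HOL-Combinatorics.Multiset_Permutations"
    "HOL-Analysis.Complex_Transcendental"
begin

text \<open>
  By the \<open>q\<close>-binomial theorem, the generating function of \<open>M\<^sub>0(n) - M\<^sub>1(n)\<close> is
  \<open>(q)\<^sub>\<infinity> / (-q)\<^sub>\<infinity>\<^sup>2\<close> up to a linear polynomial. Gauss's identity
  \<open>(q)\<^sub>\<infinity> / (-q)\<^sub>\<infinity> = \<Sum>\<^sub>k (-1)\<^sup>k q\<^bsup>k\<^sup>2\<^esup>\<close> and Euler's identity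
  \<open>1 / (-q)\<^sub>\<infinity> = (q;q\<^sup>2)\<^sub>\<infinity>\<close> then bound \<open>\<bar>M\<^sub>0(n) - M\<^sub>1(n)\<bar>\<close> by the sum of
  \<open>Q(n - k\<^sup>2)\<close> over \<open>k\<^sup>2 \<le> n\<close>, where \<open>Q\<close> counts partitions into distinct odd parts. Since
  \<open>(-q;q\<^sup>2)\<^sub>\<infinity>\<^sup>2 = \<Sum>\<^sub>k q\<^bsup>k\<^sup>2\<^esup> / (q\<^sup>2;q\<^sup>2)\<^sub>\<infinity>\<close>, comparing coefficients of \<open>q\<^bsup>2m\<^esup>\<close> gives
  \<open>Q(m)\<^sup>2 \<le> (2 \<surd>(2m) + 1) p(m)\<close>. So \<open>\<bar>M\<^sub>0(n) - M\<^sub>1(n)\<bar>\<close> is at most \<open>\<surd>p(n)\<close> times a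
  polynomial factor, and it remains to bound \<open>p(n)\<close> from below by slightly more than
  \<open>exp (\<mu>(n) / 2)\<close>. The weak compositions of \<open>n\<close> into \<open>k + 1\<close> parts show
  \<open>n\<^sup>k \<le> k! (k+1)! p(n)\<close>, and summing over \<open>k\<close> with suitable weights yields
  \<open>sinh (3 \<surd>n / 2) \<le> 8 \<surd>n p(n)\<close>.
\<close>

unbundle fps_syntax

subsection \<open>Congruence of power series and weighted partitions\<close>

text \<open>Congruence modulo X^(n+1). It lets finite products and sums stand in for the infinite
  ones of the classical identities.\<close>

definition fps_cong :: "nat \<Rightarrow> 'a::zero fps \<Rightarrow> 'a fps \<Rightarrow> bool" where
  "fps_cong n f g \<longleftrightarrow> (\<forall>i\<le>n. f $ i = g $ i)"

lemma fps_congD: "fps_cong n f g \<Longrightarrow> i \<le> n \<Longrightarrow> f $ i = g $ i"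
  by (simp add: fps_cong_def)

lemma fps_cong_refl [simp]: "fps_cong n f f"
  by (simp add: fps_cong_def)

lemma fps_cong_sym: "fps_cong n f g \<Longrightarrow> fps_cong n g f"
  by (simp add: fps_cong_def)

lemma fps_cong_trans [trans]: "fps_cong n f g \<Longrightarrow> fps_cong n g h \<Longrightarrow> fps_cong n f h"
  by (simp add: fps_cong_def)

lemma fps_cong_mono: "fps_cong n f g \<Longrightarrow> m \<le> n \<Longrightarrow> fps_cong m f g"
  by (simp add: fps_cong_def)

lemma fps_cong_add:
  fixes f g :: "'a::ring_1 fps"
  shows "fps_cong n f g \<Longrightarrow> fps_cong n f' g' \<Longrightarrow> fps_cong n (f + f') (g + g')"
  by (simp add: fps_cong_def)

lemma fps_cong_diff:
  fixes f g :: "'a::ring_1 fps"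
  shows "fps_cong n f g \<Longrightarrow> fps_cong n f' g' \<Longrightarrow> fps_cong n (f - f') (g - g')"
  by (simp add: fps_cong_def)

lemma fps_cong_mult:
  fixes f g :: "'a::ring_1 fps"
  shows "fps_cong n f g \<Longrightarrow> fps_cong n f' g' \<Longrightarrow> fps_cong n (f * f') (g * g')"
  unfolding fps_cong_def fps_mult_nth by (auto intro!: sum.cong)

lemma fps_cong_sum:
  fixes f g :: "'b \<Rightarrow> 'a::ring_1 fps"
  shows "(\<And>x. x \<in> A \<Longrightarrow> fps_cong n (f x) (g x)) \<Longrightarrow> fps_cong n (\<Sum>x\<in>A. f x) (\<Sum>x\<in>A. g x)"
  by (auto simp: fps_cong_def fps_sum_nth intro!: sum.cong)

text \<open>The gain of k in precision is what saves the outer terms in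
  \<open>gauss_theta\<close>.\<close>

lemma fps_cong_X_power_mult:
  fixes f g :: "'a::comm_ring_1 fps"
  assumes "fps_cong n f g"
  shows "fps_cong (n + k) (fps_X ^ k * f) (fps_X ^ k * g)"
  using assms by (auto simp: fps_cong_def fps_X_power_mult_nth)

lemma fps_cong_mult_cancel:
  fixes f g h :: "'a::field fps"
  assumes "fps_cong n (h * f) (h * g)" "h $ 0 \<noteq> 0"
  shows "fps_cong n f g"
proof -
  have "fps_cong n (inverse h * (h * f)) (inverse h * (h * g))"
    by (intro fps_cong_mult assms fps_cong_refl)
  then show ?thesis
    using assms(2) by (simp add: inverse_mult_eq_1 flip: mult.assoc)
qed

lemma fps_cong_prod_extend:
  fixes f :: "nat \<Rightarrow> 'a::comm_ring_1 fps"
  assumes "A \<subseteq> B" "finite B" "\<And>i. i \<in> B - A \<Longrightarrow> fps_cong n (f i) 1"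
  shows "fps_cong n (\<Prod>i\<in>B. f i) (\<Prod>i\<in>A. f i)"
proof -
  have *: "fps_cong n (\<Prod>i\<in>C. f i) 1" if "finite C" "C \<subseteq> B - A" for C
    using that
  proof (induction C)
    case (insert x C)
    have "fps_cong n (f x * (\<Prod>i\<in>C. f i)) (1 * 1)"
      by (intro fps_cong_mult assms insert) (use insert in auto)
    then show ?case using insert by simp
  qed simp
  have "(\<Prod>i\<in>B. f i) = (\<Prod>i\<in>B - A. f i) * (\<Prod>i\<in>A. f i)"
    by (intro prod.subset_diff assms)
  moreover have "fps_cong n ((\<Prod>i\<in>B - A. f i) * (\<Prod>i\<in>A. f i)) (1 * (\<Prod>i\<in>A. f i))"
    by (intro fps_cong_mult *) (use assms in auto)
  ultimately show ?thesis by simp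
qed

lemma prod_nth_0: "(\<Prod>i\<in>A. f i) $ 0 = (\<Prod>i\<in>A. (f i :: 'a::comm_ring_1 fps) $ 0)"
  by (induction A rule: infinite_finite_induct) auto

section \<open>Generating functions of weighted partitions\<close>

definition bounded_msets :: "nat set \<Rightarrow> nat \<Rightarrow> nat multiset set" where
  "bounded_msets A n = {L. set_mset L \<subseteq> A \<and> sum_mset L = n}"

lemma finite_bounded_msets:
  assumes "0 \<notin> A"
  shows "finite (bounded_msets A n)"
  by (rule finite_subset[OF _ finite_partitions[of n]])
     (use assms in \<open>auto simp: bounded_msets_def partitions_def\<close>)

text \<open>Induction on \<open>A\<close>. A multiset over \<open>insert a A\<close> either avoids
  \<open>a\<close> or arises by adding one copy of \<open>a\<close>, so S(insert a A) = S(A) + w(a)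
  X^a S(insert a A). As \<open>a\<close> is positive, the factor 1 - w(a) X^a is invertible.\<close>

theorem weighted_partition_gf:
  fixes w :: "nat \<Rightarrow> 'a::field"
  assumes "finite A" "0 \<notin> A"
  shows "(\<Prod>i\<in>A. inverse (1 - fps_const (w i) * fps_X ^ i)) $ n =
           (\<Sum>L\<in>bounded_msets A n. \<Prod>i\<in>#L. w i)"
proof -
  define S where "S A = Abs_fps (\<lambda>n. \<Sum>L\<in>bounded_msets A n. \<Prod>i\<in>#L. w i)" for A
  have "(\<Prod>i\<in>A. inverse (1 - fps_const (w i) * fps_X ^ i)) = S A"
    using assms
  proof (induction A)
    case empty
    have "bounded_msets {} n = (if n = 0 then {{#}} else {})" for n
      by (auto simp: bounded_msets_def)
    then show ?case by (auto simp: S_def fps_eq_iff)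
  next
    case (insert a A)
    define h where "h = 1 - fps_const (w a) * fps_X ^ a"
    have a: "a > 0" using insert by auto
    have "h * S (insert a A) = S A"
    proof (rule fps_ext)
      fix n
      let ?B = "bounded_msets (insert a A) n"
      have fin: "finite ?B" by (intro finite_bounded_msets) (use insert in auto)
      have "(\<Sum>L\<in>?B. \<Prod>i\<in>#L. w i) =
              (\<Sum>L\<in>{L\<in>?B. a \<in># L}. \<Prod>i\<in>#L. w i) + (\<Sum>L\<in>{L\<in>?B. a \<notin># L}. \<Prod>i\<in>#L. w i)"
        using fin by (subst sum.union_disjoint[symmetric]) (auto intro!: sum.cong)
      also have "{L\<in>?B. a \<notin># L} = bounded_msets A n"
        using insert.hyps by (auto simp: bounded_msets_def)
      also have "(\<Sum>L\<in>{L\<in>?B. a \<in># L}. \<Prod>i\<in>#L. w i) =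
          (if n < a then 0 else w a * S (insert a A) $ (n - a))"
      proof (cases "n < a")
        case True
        have e: "{L\<in>?B. a \<in># L} = {}"
          using True by (fastforce simp: bounded_msets_def dest: multi_member_split)
        show ?thesis unfolding e using True by simp
      next
        case False
        have "(\<Sum>L\<in>{L\<in>?B. a \<in># L}. \<Prod>i\<in>#L. w i) =
              (\<Sum>L\<in>bounded_msets (insert a A) (n - a). \<Prod>i\<in>#add_mset a L. w i)"
          by (rule sum.reindex_bij_witness[of _ "add_mset a" "\<lambda>L. L - {#a#}"])
             (use False in \<open>auto simp: bounded_msets_def sum_mset.remove dest: in_diffD\<close>)
        then show ?thesis using False by (simp add: S_def sum_distrib_left)
      qed
      finally show "(h * S (insert a A)) $ n = S A $ n"
        by (simp add: h_def algebra_simps fps_X_power_mult_nth S_def flip: mult.assoc)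
           (simp add: mult.assoc fps_X_power_mult_nth)
    qed
    moreover have "h $ 0 = 1" using a by (simp add: h_def)
    ultimately have "S (insert a A) = inverse h * S A"
      by (metis inverse_mult_eq_1 mult.assoc mult_1 zero_neq_one)
    then show ?case using insert by (simp add: h_def)
  qed
  then show ?thesis by (simp add: S_def)
qed

subsection \<open>The q-binomial series\<close>

text \<open>The q-Pochhammer symbol (zq; q)_n, so z = 1 and z = -1 give (q)_n and (-q)_n.\<close>

definition qpoch :: "real \<Rightarrow> nat \<Rightarrow> real fps" where
  "qpoch z n = (\<Prod>i=1..n. 1 - fps_const z * fps_X ^ i)"

lemma qpoch_0 [simp]: "qpoch z 0 = 1"
  by (simp add: qpoch_def)

lemma qpoch_Suc: "qpoch z (Suc n) = qpoch z n * (1 - fps_const z * fps_X ^ Suc n)"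
  by (simp add: qpoch_def)

lemma qpoch_nth_0 [simp]: "qpoch z n $ 0 = 1"
  by (simp add: qpoch_def prod_nth_0)

lemma fps_inverse_prod:
  fixes f :: "'b \<Rightarrow> 'a::field fps"
  shows "inverse (\<Prod>i\<in>A. f i) = (\<Prod>i\<in>A. inverse (f i))"
  by (induction A rule: infinite_finite_induct) (simp_all add: fps_inverse_mult)

lemma qpoch_Suc_mult_inverse:
  "(1 - fps_const z * fps_X ^ Suc n) * inverse (qpoch z (Suc n)) = inverse (qpoch z n)"
  by (simp add: qpoch_Suc fps_inverse_mult flip: mult.assoc)
     (subst mult.commute, simp add: inverse_mult_eq_1 flip: mult.assoc)

text \<open>This is the functional equation (1 - t) H(t) = (1 - aqt) H(qt) of H(t) = sum of A_j t^j,
  taken at t = -q^i. It encodes the recurrence A_(j+1) (1 - q^(j+1)) = A_j (1 - a q^(j+1)). Cutting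
  the series off at j = n costs only a term of order at least i(n+1), which exceeds n.\<close>

lemma qbinomial_series_step:
  fixes a :: real and n i :: nat
  defines "A \<equiv> \<lambda>j. qpoch a j * inverse (qpoch 1 j)"
  defines "h \<equiv> \<lambda>i. \<Sum>j\<le>n. (-1) ^ j * fps_X ^ (i * j) * A j"
  assumes "i > 0"
  shows "fps_cong n ((1 + fps_X ^ i) * h i) ((1 + fps_const a * fps_X ^ Suc i) * h (Suc i))"
proof -
  let ?X = "fps_X :: real fps"
  define c where "c j = (-1) ^ j * A j" for j
  have h: "h i = (\<Sum>j\<le>n. c j * ?X ^ (i * j))" for i
    by (simp add: h_def c_def mult_ac)
  have A: "A (Suc j) * (1 - ?X ^ Suc j) = A j * (1 - fps_const a * ?X ^ Suc j)" for j
    using qpoch_Suc_mult_inverse[of 1 j] by (simp add: A_def qpoch_Suc mult_ac)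
  have c: "c (Suc j) * (1 - ?X ^ Suc j) = - c j * (1 - fps_const a * ?X ^ Suc j)" for j
    by (simp only: c_def mult.assoc A mult_minus_left) (simp only: power_Suc mult_minus_left mult_1)
  \<comment> \<open>The factor 1 - X^j kills the term j = 0, so the index can be shifted and the
    recurrence applied.\<close>
  have "h i - h (Suc i) = (\<Sum>j\<le>n. c j * (1 - ?X ^ j) * ?X ^ (i * j))"
    by (simp add: h algebra_simps power_add sum_subtractf)
  also have "\<dots> = (\<Sum>j<n. c (Suc j) * (1 - ?X ^ Suc j) * ?X ^ (i * Suc j))"
    by (cases n) (simp_all add: sum.atMost_Suc_shift lessThan_Suc_atMost del: sum.atMost_Suc power_Suc)
  also have "\<dots> = - (\<Sum>j<n. c j * (1 - fps_const a * ?X ^ Suc j) * ?X ^ (i * Suc j))"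
    unfolding c by (simp add: sum_negf del: power_Suc)
  also have "fps_cong n \<dots> (- (\<Sum>j\<le>n. c j * (1 - fps_const a * ?X ^ Suc j) * ?X ^ (i * Suc j)))"
  proof -
    have "n < i * Suc n" using \<open>i > 0\<close> by (cases i) auto
    then have "fps_cong n 0 (?X ^ (i * Suc n) * (c n * (1 - fps_const a * ?X ^ Suc n)))"
      by (auto simp: fps_cong_def fps_X_power_mult_nth simp del: power_Suc)
    then show ?thesis
      by (auto simp: fps_cong_def lessThan_Suc_atMost[symmetric] mult_ac simp del: power_Suc)
  qed
  also have "(\<Sum>j\<le>n. c j * (1 - fps_const a * ?X ^ Suc j) * ?X ^ (i * Suc j)) =
               ?X ^ i * h i - fps_const a * ?X ^ Suc i * h (Suc i)"
    by (simp add: h algebra_simps power_add sum_subtractf sum_distrib_left)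
  finally have "fps_cong n (h i - h (Suc i)) (- (?X ^ i * h i - fps_const a * ?X ^ Suc i * h (Suc i)))" .
  then have "fps_cong n ((h i - h (Suc i)) + (?X ^ i * h i + h (Suc i)))
     (- (?X ^ i * h i - fps_const a * ?X ^ Suc i * h (Suc i)) + (?X ^ i * h i + h (Suc i)))"
    by (intro fps_cong_add) auto
  then show ?thesis by (simp add: algebra_simps)
qed

text \<open>The case \<open>t = -q\<close> of the \<open>q\<close>-binomial theorem
  \<open>\<Sum>\<^sub>j (aq)\<^sub>j / (q)\<^sub>j t\<^sup>j = (aqt)\<^sub>\<infinity> / (t)\<^sub>\<infinity>\<close>.\<close>

lemma qbinomial_series:
  fixes a :: real and n :: nat
  shows "fps_cong n (qpoch (-1) n * (\<Sum>j\<le>n. (-1) ^ j * fps_X ^ j * (qpoch a j * inverse (qpoch 1 j))))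
           (\<Prod>i=1..n. 1 + fps_const a * fps_X ^ Suc i)"
proof -
  define h where "h i = (\<Sum>j\<le>n. (-1) ^ j * fps_X ^ (i * j) * (qpoch a j * inverse (qpoch 1 j)))" for i
  \<comment> \<open>Iterating the functional equation m times pushes the argument to X^(m+1). At m =
    n every term of \<open>h (Suc n)\<close> except j = 0 has order above n.\<close>
  have "fps_cong n (qpoch (-1) m * h 1) ((\<Prod>i=1..m. 1 + fps_const a * fps_X ^ Suc i) * h (Suc m))" for m
  proof (induction m)
    case (Suc m)
    have "fps_cong n ((1 + fps_X ^ Suc m) * (qpoch (-1) m * h 1))
           ((1 + fps_X ^ Suc m) * ((\<Prod>i=1..m. 1 + fps_const a * fps_X ^ Suc i) * h (Suc m)))"
      by (intro fps_cong_mult fps_cong_refl Suc)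
    also have "\<dots> = (\<Prod>i=1..m. 1 + fps_const a * fps_X ^ Suc i) * ((1 + fps_X ^ Suc m) * h (Suc m))"
      by (simp add: mult_ac)
    also have "fps_cong n \<dots> ((\<Prod>i=1..m. 1 + fps_const a * fps_X ^ Suc i) *
                  ((1 + fps_const a * fps_X ^ Suc (Suc m)) * h (Suc (Suc m))))"
      unfolding h_def by (intro fps_cong_mult fps_cong_refl qbinomial_series_step) auto
    finally show ?case by (simp add: qpoch_Suc mult_ac flip: fps_const_neg)
  qed simp
  from this[of n] have "fps_cong n (qpoch (-1) n * h 1)
      ((\<Prod>i=1..n. 1 + fps_const a * fps_X ^ Suc i) * h (Suc n))" .
  also have "fps_cong n \<dots> ((\<Prod>i=1..n. 1 + fps_const a * fps_X ^ Suc i) * 1)"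
  proof (intro fps_cong_mult fps_cong_refl)
    have "h (Suc n) = (\<Sum>j\<in>insert 0 {1..n}. (-1) ^ j * fps_X ^ (Suc n * j) * (qpoch a j * inverse (qpoch 1 j)))"
      unfolding h_def by (intro sum.cong) auto
    also have "\<dots> = 1 + (\<Sum>j=1..n. fps_X ^ (Suc n * j) * ((-1) ^ j * (qpoch a j * inverse (qpoch 1 j))))"
      by (subst sum.insert) (auto simp: mult_ac)
    also have "fps_cong n \<dots> (1 + (\<Sum>j=1..n. 0))"
    proof (intro fps_cong_add fps_cong_sum fps_cong_refl)
      fix j assume "j \<in> {1..n}"
      then have "n < Suc n * j" by (cases j) auto
      then show "fps_cong n (fps_X ^ (Suc n * j) * ((-1) ^ j * (qpoch a j * inverse (qpoch 1 j)))) 0"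
        by (auto simp: fps_cong_def fps_X_power_mult_nth)
    qed
    finally show "fps_cong n (h (Suc n)) 1" by simp
  qed
  finally show ?thesis by (simp add: h_def)
qed

subsection \<open>The crank parity generating function\<close>

text \<open>This is (-1)^crank, by cases because the crank may be negative.\<close>

definition crank_sign :: "nat multiset \<Rightarrow> real" where
  "crank_sign L = (if even (crank L) then 1 else - 1)"

lemma fps_const_minus_one_power: "fps_const ((-1) ^ m) = (-1 :: 'a::comm_ring_1 fps) ^ m"
  by (induction m) (simp_all flip: fps_const_mult fps_const_neg)

lemma prod_mset_if_neg:
  "(\<Prod>i\<in>#L. if P i then 1 else - 1 :: 'a::comm_ring_1) = (-1) ^ size {#i \<in># L. \<not> P i#}"
  by (induction L) auto

text \<open>Without ones the crank is the largest part m. Removing one copy of m leaves any multiset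
  of parts from 2 to m with sum n - m. Positivity of n keeps the empty multiset, where
  \<open>Max\<close> is unspecified, out of the sum.\<close>

lemma sum_crank_sign_no_ones:
  assumes "n > 0"
  shows "(\<Sum>L | L \<in> partitions n \<and> omega L = 0. crank_sign L) =
    (\<Sum>m=2..n. (-1) ^ m * fps_X ^ m * (\<Prod>i=2..m. inverse (1 - fps_X ^ i))) $ n"
proof -
  let ?S = "{L \<in> partitions n. omega L = 0}"
  have fin: "finite ?S" using finite_partitions by simp
  have parts: "x \<in> {2..n}" if "L \<in> ?S" "x \<in># L" for L x
  proof -
    have "x \<noteq> 0" "x \<noteq> 1"
      using that by (auto simp: partitions_def omega_def count_eq_zero_iff intro!: Nat.gr0I)
    moreover have "x \<le> n" using that by (auto simp: partitions_def dest: multi_member_split)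
    ultimately show ?thesis by auto
  qed
  have nonempty: "L \<noteq> {#}" if "L \<in> ?S" for L
    using that assms by (auto simp: partitions_def)
  have maxin: "Max (set_mset L) \<in># L" if "L \<in> ?S" for L
    using nonempty[OF that] by (intro Max_in) auto
  have "(\<Sum>L\<in>?S. crank_sign L) =
      (\<Sum>m=2..n. \<Sum>L | L \<in> ?S \<and> Max (set_mset L) = m. crank_sign L)"
    by (rule sum.group[symmetric]) (use fin maxin parts in blast)+
  also have "\<dots> = (\<Sum>m=2..n. (-1) ^ m * (\<Sum>L\<in>bounded_msets {2..m} (n - m). 1))"
  proof (rule sum.cong[OF refl])
    fix m assume m: "m \<in> {2..n}"
    have "(\<Sum>L | L \<in> ?S \<and> Max (set_mset L) = m. crank_sign L) =
        (\<Sum>L\<in>bounded_msets {2..m} (n - m). (-1) ^ m)"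
    proof (rule sum.reindex_bij_witness[of _ "add_mset m" "\<lambda>L. L - {#m#}"])
      fix L assume L: "L \<in> {L \<in> ?S. Max (set_mset L) = m}"
      then have mL: "m \<in># L" using maxin by blast
      show "add_mset m (L - {#m#}) = L" using mL by simp
      have "set_mset L \<subseteq> {2..m}" using L parts by (auto intro: Max_ge)
      moreover have "sum_mset (L - {#m#}) = n - m"
        using L sum_mset.remove[OF mL] by (auto simp: partitions_def)
      ultimately show "L - {#m#} \<in> bounded_msets {2..m} (n - m)"
        by (auto simp: bounded_msets_def dest: in_diffD)
      show "(-1) ^ m = crank_sign L"
        using L by (auto simp: crank_sign_def crank_def uminus_power_if)
    next
      fix L assume L: "L \<in> bounded_msets {2..m} (n - m)"
      then show "add_mset m L - {#m#} = L" by simp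
      have "Max (set_mset (add_mset m L)) = m"
        using L by (intro Max_eqI) (auto simp: bounded_msets_def)
      then show "add_mset m L \<in> {L \<in> ?S. Max (set_mset L) = m}"
        using L m by (auto simp: bounded_msets_def partitions_def omega_def count_eq_zero_iff)
    qed
    then show "(\<Sum>L | L \<in> ?S \<and> Max (set_mset L) = m. crank_sign L) =
        (-1) ^ m * (\<Sum>L\<in>bounded_msets {2..m} (n - m). 1)" by simp
  qed
  also have "\<dots> = (\<Sum>m=2..n. (-1) ^ m * fps_X ^ m * (\<Prod>i=2..m. inverse (1 - fps_X ^ i))) $ n"
    unfolding fps_sum_nth
  proof (rule sum.cong[OF refl])
    fix m assume m: "m \<in> {2..n}"
    have "((-1) ^ m * (fps_X :: real fps) ^ m * (\<Prod>i=2..m. inverse (1 - fps_X ^ i))) $ n =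
       (fps_const ((-1) ^ m) * (fps_X ^ m * (\<Prod>i=2..m. inverse (1 - fps_const 1 * fps_X ^ i)))) $ n"
      by (simp only: mult.assoc fps_const_minus_one_power fps_const_1_eq_1 mult_1)
    also have "\<dots> = (-1) ^ m * (\<Prod>i=2..m. inverse (1 - fps_const 1 * fps_X ^ i)) $ (n - m)"
      using m by (subst fps_mult_left_const_nth, subst fps_X_power_mult_nth) simp
    also have "\<dots> = (-1) ^ m * (\<Sum>L\<in>bounded_msets {2..m} (n - m). 1)"
      by (subst weighted_partition_gf) auto
    finally show "(-1 :: real) ^ m * (\<Sum>L\<in>bounded_msets {2..m} (n - m). 1) =
        ((-1) ^ m * fps_X ^ m * (\<Prod>i=2..m. inverse (1 - fps_X ^ i))) $ n" by simp
  qed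
  finally show ?thesis by simp
qed

text \<open>With j ones the sign is (-1)^j times a factor -1 for each part above j. After deletion
  of the ones, parts from 2 to j have weight 1 and larger parts weight -1, which produces the two
  products.\<close>

lemma sum_crank_sign_ones:
  assumes "j \<in> {1..n}"
  shows "(\<Sum>L | L \<in> partitions n \<and> omega L = j. crank_sign L) =
    ((-1) ^ j * fps_X ^ j *
      ((\<Prod>i=2..j. inverse (1 - fps_X ^ i)) * (\<Prod>i=Suc j..n. inverse (1 + fps_X ^ i)))) $ n"
proof -
  let ?S = "{L \<in> partitions n. omega L = j}"
  define w :: "nat \<Rightarrow> real" where "w i = (if i \<le> j then 1 else - 1)" for i
  have "(\<Sum>L\<in>?S. crank_sign L) = (\<Sum>L\<in>bounded_msets {2..n} (n - j). (-1) ^ j * (\<Prod>i\<in>#L. w i))"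
  proof (rule sum.reindex_bij_witness[of _ "\<lambda>L. L + replicate_mset j 1" "\<lambda>L. {#i\<in>#L. i \<noteq> 1#}"])
    fix L assume L: "L \<in> ?S"
    have split: "L = {#i\<in>#L. i \<noteq> 1#} + replicate_mset j 1"
      using L multiset_partition[of L "\<lambda>i. i \<noteq> 1"] by (simp add: omega_def filter_eq_replicate_mset)
    then show "{#i\<in>#L. i \<noteq> 1#} + replicate_mset j 1 = L" by simp
    have "x \<in> {2..n}" if "x \<in># L" "x \<noteq> 1" for x
    proof -
      have "x \<noteq> 0" using that L by (auto simp: partitions_def intro!: Nat.gr0I)
      moreover have "x \<le> n" using that L by (auto simp: partitions_def dest: multi_member_split)
      ultimately show ?thesis using that by auto
    qed
    moreover have "sum_mset {#i\<in>#L. i \<noteq> 1#} = n - j"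
      using L arg_cong[OF split, of sum_mset] by (auto simp: partitions_def)
    ultimately show "{#i\<in>#L. i \<noteq> 1#} \<in> bounded_msets {2..n} (n - j)"
      by (auto simp: bounded_msets_def)
    have "{#i\<in>#L. j < i#} = {#i\<in>#{#i\<in>#L. i \<noteq> 1#}. \<not> i \<le> j#}"
      using assms by (auto simp: filter_filter_mset intro!: filter_mset_cong)
    then have "nu L = size {#i\<in>#{#i\<in>#L. i \<noteq> 1#}. \<not> i \<le> j#}"
      using L by (auto simp: nu_def)
    then have "(\<Prod>i\<in>#{#i\<in>#L. i \<noteq> 1#}. w i) = (-1) ^ nu L"
      unfolding w_def by (subst prod_mset_if_neg) simp
    then show "(-1) ^ j * (\<Prod>i\<in>#{#i\<in>#L. i \<noteq> 1#}. w i) = crank_sign L"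
      using L assms by (auto simp: crank_sign_def crank_def uminus_power_if)
  next
    fix L assume L: "L \<in> bounded_msets {2..n} (n - j)"
    then have "1 \<notin># L" "0 \<notin># L" by (auto simp: bounded_msets_def)
    then have "{#i\<in>#L. i \<noteq> 1#} = L"
      by (auto simp: filter_mset_eq_conv)
    moreover have "{#i\<in>#replicate_mset j 1. i \<noteq> 1#} = {#}" for j :: nat
      by (induction j) auto
    ultimately show "{#i\<in>#L + replicate_mset j 1. i \<noteq> 1#} = L" by simp
    show "L + replicate_mset j 1 \<in> ?S"
      using L assms \<open>1 \<notin># L\<close> \<open>0 \<notin># L\<close>
      by (auto simp: partitions_def bounded_msets_def omega_def count_eq_zero_iff)
  qed
  also have "\<dots> = (-1) ^ j * (\<Prod>i=2..n. inverse (1 - fps_const (w i) * fps_X ^ i)) $ (n - j)"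
    by (subst weighted_partition_gf) (auto simp: sum_distrib_left)
  also have "(\<Prod>i=2..n. inverse (1 - fps_const (w i) * fps_X ^ i)) =
     (\<Prod>i\<in>{2..j} \<union> {Suc j..n} - {1}. inverse (1 - fps_const (w i) * fps_X ^ i))"
    by (rule prod.cong) (use assms in auto)
  also have "\<dots> = (\<Prod>i=2..j. inverse (1 - fps_const (w i) * fps_X ^ i)) *
                    (\<Prod>i=Suc j..n. inverse (1 - fps_const (w i) * fps_X ^ i))"
    by (subst prod.union_disjoint[symmetric]) (use assms in \<open>auto intro!: prod.cong\<close>)
  also have "(\<Prod>i=2..j. inverse (1 - fps_const (w i) * fps_X ^ i)) = (\<Prod>i=2..j. inverse (1 - fps_X ^ i))"
    by (rule prod.cong) (auto simp: w_def)
  also have "(\<Prod>i=Suc j..n. inverse (1 - fps_const (w i) * fps_X ^ i)) =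
              (\<Prod>i=Suc j..n. inverse (1 + fps_X ^ i))"
    by (rule prod.cong) (auto simp: w_def simp flip: fps_const_neg)
  also have "(-1) ^ j * ((\<Prod>i=2..j. inverse (1 - (fps_X :: real fps) ^ i)) *
        (\<Prod>i=Suc j..n. inverse (1 + fps_X ^ i))) $ (n - j) =
     (fps_const ((-1) ^ j) * (fps_X ^ j *
      ((\<Prod>i=2..j. inverse (1 - fps_X ^ i)) * (\<Prod>i=Suc j..n. inverse (1 + fps_X ^ i))))) $ n"
    using assms by (subst fps_mult_left_const_nth, subst fps_X_power_mult_nth) simp
  also have "\<dots> = ((-1) ^ j * fps_X ^ j *
      ((\<Prod>i=2..j. inverse (1 - fps_X ^ i)) * (\<Prod>i=Suc j..n. inverse (1 + fps_X ^ i)))) $ n"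
    by (simp only: mult.assoc fps_const_minus_one_power)
  finally show ?thesis by simp
qed

text \<open>Sum over the number of ones; the factor 1 - X makes up for the absent part 1. The
  q-binomial series with a = 0 and a = -1 gives B = 1/(-q) and (1 - X) C = (q)/(-q), up to order n.
  The contribution of B cancels against the missing j = 0 term of C, leaving the polynomial 2X - 1,
  which does not reach degree 2.\<close>

theorem crank_parity_gf:
  assumes "n \<ge> 2"
  shows "(\<Sum>L\<in>partitions n. crank_sign L) = (qpoch 1 n * inverse (qpoch (-1) n) ^ 2) $ n"
proof -
  let ?X = "fps_X :: real fps"
  define B where "B = (\<Sum>m\<le>n. (-1) ^ m * ?X ^ m * inverse (qpoch 1 m))"
  define C where "C = (\<Sum>j\<le>n. (-1) ^ j * ?X ^ j * (qpoch (-1) j * inverse (qpoch 1 j)))"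
  define q1 where "q1 = qpoch 1 n"
  define q2 where "q2 = qpoch (-1) n"
  have inv2 [simp]: "inverse q2 * q2 = 1" by (simp add: q2_def inverse_mult_eq_1)
  have inv: "(\<Prod>i=2..m. inverse (1 - ?X ^ i)) = (1 - ?X) * inverse (qpoch 1 m)" if "m \<ge> 1" for m
  proof -
    have "(1 - ?X) * inverse (qpoch 1 m) = (1 - ?X) * (inverse (1 - ?X) * (\<Prod>i=2..m. inverse (1 - ?X ^ i)))"
      using that by (simp add: qpoch_def fps_inverse_mult fps_inverse_prod prod.atLeast_Suc_atMost numeral_2_eq_2)
    also have "\<dots> = (\<Prod>i=2..m. inverse (1 - ?X ^ i))"
      by (simp add: inverse_mult_eq_1' flip: mult.assoc)
    finally show ?thesis by simp
  qed
  have inv': "(\<Prod>i=Suc j..n. inverse (1 + ?X ^ i)) = qpoch (-1) j * inverse q2" if "j \<le> n" for j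
  proof -
    have "{1..n} = {1..j} \<union> {Suc j..n}" using that by auto
    then have "q2 = qpoch (-1) j * (\<Prod>i=Suc j..n. 1 + ?X ^ i)"
      unfolding q2_def qpoch_def by (simp add: prod.union_disjoint flip: fps_const_neg)
    then have "qpoch (-1) j * inverse q2 = (qpoch (-1) j * inverse (qpoch (-1) j)) * inverse (\<Prod>i=Suc j..n. 1 + ?X ^ i)"
      by (simp add: fps_inverse_mult mult_ac)
    then show ?thesis by (simp add: inverse_mult_eq_1' fps_inverse_prod)
  qed
  have "(\<Sum>L\<in>partitions n. crank_sign L) =
      (\<Sum>j=0..n. \<Sum>L | L \<in> partitions n \<and> omega L = j. crank_sign L)"
  proof (rule sum.group[symmetric])
    show "omega ` partitions n \<subseteq> {0..n}"
    proof safe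
      fix L assume "L \<in> partitions n"
      have "count L 1 \<le> sum_mset L" for L :: "nat multiset" by (induction L) auto
      from this[of L] show "omega L \<in> {0..n}"
        using \<open>L \<in> partitions n\<close> by (auto simp: omega_def partitions_def)
    qed
  qed (auto simp: finite_partitions)
  also have "\<dots> = (\<Sum>L | L \<in> partitions n \<and> omega L = 0. crank_sign L) +
       (\<Sum>j=1..n. \<Sum>L | L \<in> partitions n \<and> omega L = j. crank_sign L)"
    by (simp add: sum.atLeast_Suc_atMost)
  also have "(\<Sum>L | L \<in> partitions n \<and> omega L = 0. crank_sign L) =
      (\<Sum>m=2..n. (-1) ^ m * ?X ^ m * ((1 - ?X) * inverse (qpoch 1 m))) $ n"
    by (subst sum_crank_sign_no_ones) (use assms in \<open>simp_all add: inv\<close>)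
  also have "(\<Sum>m=2..n. (-1) ^ m * ?X ^ m * ((1 - ?X) * inverse (qpoch 1 m))) =
      (1 - ?X) * (\<Sum>m=2..n. (-1) ^ m * ?X ^ m * inverse (qpoch 1 m))"
    by (simp add: sum_distrib_left mult_ac)
  also have "(\<Sum>m=2..n. (-1) ^ m * ?X ^ m * inverse (qpoch 1 m)) = B - (1 - ?X * inverse (1 - ?X))"
  proof -
    have "{..n} = insert 0 (insert 1 {2..n})" using assms by auto
    then show ?thesis by (simp add: B_def qpoch_def)
  qed
  also have "(\<Sum>j=1..n. \<Sum>L | L \<in> partitions n \<and> omega L = j. crank_sign L) =
     (\<Sum>j=1..n. (-1) ^ j * ?X ^ j * ((1 - ?X) * inverse (qpoch 1 j) * (qpoch (-1) j * inverse q2))) $ n"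
    unfolding fps_sum_nth
    by (intro sum.cong refl, subst sum_crank_sign_ones) (simp_all add: inv inv')
  also have "(\<Sum>j=1..n. (-1) ^ j * ?X ^ j * ((1 - ?X) * inverse (qpoch 1 j) * (qpoch (-1) j * inverse q2))) =
     (1 - ?X) * (inverse q2 * (\<Sum>j=1..n. (-1) ^ j * ?X ^ j * (qpoch (-1) j * inverse (qpoch 1 j))))"
    by (simp add: sum_distrib_left mult_ac)
  also have "(\<Sum>j=1..n. (-1) ^ j * ?X ^ j * (qpoch (-1) j * inverse (qpoch 1 j))) = C - 1"
    by (simp add: C_def atLeast0AtMost[symmetric] sum.atLeast_Suc_atMost)
  also have "((1 - ?X) * (B - (1 - ?X * inverse (1 - ?X)))) $ n + ((1 - ?X) * (inverse q2 * (C - 1))) $ n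
     = ((1 - ?X) * (B - (1 - ?X * inverse (1 - ?X))) + (1 - ?X) * (inverse q2 * (C - 1))) $ n"
    by simp
  also have "(1 - ?X) * (B - (1 - ?X * inverse (1 - ?X))) + (1 - ?X) * (inverse q2 * (C - 1)) =
     (1 - ?X) * (B - inverse q2) + inverse q2 * ((1 - ?X) * C) + (- (1 - ?X) + ?X * ((1 - ?X) * inverse (1 - ?X)))"
    by (simp add: algebra_simps)
  also have "(1 - ?X) * inverse (1 - ?X) = 1"
    by (simp add: inverse_mult_eq_1')
  also have "((1 - ?X) * (B - inverse q2) + inverse q2 * ((1 - ?X) * C) + (- (1 - ?X) + ?X * 1)) $ n =
     ((1 - ?X) * (inverse q2 - inverse q2) + inverse q2 * (q1 * inverse q2) + (- (1 - ?X) + ?X * 1)) $ n"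
  proof -
    have "fps_cong n (q2 * B) 1"
      using qbinomial_series[of n 0] by (simp add: q2_def B_def qpoch_def)
    then have "fps_cong n (q2 * B) (q2 * inverse q2)"
      by (simp add: q2_def inverse_mult_eq_1')
    then have B: "fps_cong n B (inverse q2)"
      by (rule fps_cong_mult_cancel) (simp add: q2_def)
    have "fps_cong n (q2 * C) (\<Prod>i=1..n. 1 - ?X ^ Suc i)"
      using qbinomial_series[of n "-1"] by (simp add: q2_def C_def flip: fps_const_neg)
    then have "fps_cong n ((1 - ?X) * (q2 * C)) ((1 - ?X) * (\<Prod>i=1..n. 1 - ?X ^ Suc i))"
      by (intro fps_cong_mult fps_cong_refl)
    also have "(1 - ?X) * (\<Prod>i=1..n. 1 - ?X ^ Suc i) = (\<Prod>i=0..n. 1 - ?X ^ Suc i)"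
      by (simp add: prod.atLeast_Suc_atMost)
    also have "\<dots> = (\<Prod>i=1..Suc n. 1 - ?X ^ i)"
      by (simp only: prod.shift_bounds_cl_Suc_ivl One_nat_def)
    also have "fps_cong n \<dots> q1"
      unfolding q1_def qpoch_def fps_const_1_eq_1 mult_1
      by (intro fps_cong_prod_extend) (auto simp: fps_cong_def)
    also have "q1 = q2 * (q1 * inverse q2)"
      by (metis inv2 mult.assoc mult.commute mult_1_right)
    finally have "fps_cong n (q2 * ((1 - ?X) * C)) (q2 * (q1 * inverse q2))"
      by (simp only: mult.left_commute)
    then have C: "fps_cong n ((1 - ?X) * C) (q1 * inverse q2)"
      by (rule fps_cong_mult_cancel) (simp add: q2_def)
    show ?thesis
      by (rule fps_congD[of n]) (intro fps_cong_add fps_cong_mult fps_cong_diff B C fps_cong_refl order.refl)+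
  qed
  also have "\<dots> = (q1 * inverse q2 ^ 2) $ n"
    using assms by (simp add: power2_eq_square mult_ac numeral_fps_const)
  finally show ?thesis by (simp add: q1_def q2_def)
qed

subsection \<open>The finite triple product\<close>

text \<open>The Gaussian binomial coefficients to base \<open>q\<^sup>2\<close>.\<close>

fun qbin :: "nat \<Rightarrow> nat \<Rightarrow> real fps" where
  "qbin n 0 = 1"
| "qbin 0 (Suc k) = 0"
| "qbin (Suc n) (Suc k) = qbin n (Suc k) + fps_X ^ (2 * (n - k)) * qbin n k"

lemma qbin_eq_0: "n < k \<Longrightarrow> qbin n k = 0"
  by (induction n k rule: qbin.induct) auto

text \<open>The homogeneous variable \<open>y\<close> allows the triple product to use y = X^(2n-1)
  in place of a negative power of X.\<close>

theorem q_binomial_theorem: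
  "(\<Prod>i<m. y + x * fps_X ^ (2 * i)) = (\<Sum>k\<le>m. fps_X ^ (k * (k - 1)) * qbin m k * x ^ k * y ^ (m - k))"
proof (induction m)
  case (Suc m)
  let ?X = "fps_X :: real fps"
  define c where "c k = ?X ^ (k * (k - 1)) * qbin m k * x ^ k * y ^ (m - k)" for k
  define A where "A k = ?X ^ (k * (k - 1)) * qbin m k * x ^ k * y ^ (Suc m - k)" for k
  have "(\<Sum>k\<le>Suc m. ?X ^ (k * (k - 1)) * qbin (Suc m) k * x ^ k * y ^ (Suc m - k)) =
     y ^ Suc m + (\<Sum>k\<le>m. ?X ^ (Suc k * k) * qbin (Suc m) (Suc k) * x ^ Suc k * y ^ (m - k))"
    by (subst sum.atMost_Suc_shift) (simp del: qbin.simps(3) power_Suc mult_Suc)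
  also have "(\<Sum>k\<le>m. ?X ^ (Suc k * k) * qbin (Suc m) (Suc k) * x ^ Suc k * y ^ (m - k)) =
      (\<Sum>k\<le>m. A (Suc k) + x * ?X ^ (2 * m) * c k)"
  proof (rule sum.cong[OF refl])
    fix k assume "k \<in> {..m}"
    then have "Suc k * k + 2 * (m - k) = 2 * m + k * (k - 1)"
      by (cases k) (auto simp: algebra_simps)
    then have "?X ^ (Suc k * k) * ?X ^ (2 * (m - k)) = ?X ^ (2 * m) * ?X ^ (k * (k - 1))"
      by (simp only: flip: power_add)
    then show "?X ^ (Suc k * k) * qbin (Suc m) (Suc k) * x ^ Suc k * y ^ (m - k) =
       A (Suc k) + x * ?X ^ (2 * m) * c k"
      by (simp add: A_def c_def distrib_left distrib_right mult.assoc mult.left_commute del: mult_Suc)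
  qed
  also have "y ^ Suc m + (\<Sum>k\<le>m. A (Suc k) + x * ?X ^ (2 * m) * c k) =
     (\<Sum>k\<le>Suc m. A k) + x * ?X ^ (2 * m) * (\<Sum>k\<le>m. c k)"
    by (subst sum.atMost_Suc_shift) (simp add: A_def sum.distrib sum_distrib_left)
  also have "(\<Sum>k\<le>Suc m. A k) = y * (\<Sum>k\<le>m. c k)"
    by (auto simp: A_def c_def qbin_eq_0 sum_distrib_left Suc_diff_le intro!: sum.cong)
  finally show ?case
    using Suc by (simp add: c_def algebra_simps)
qed simp

text \<open>The theta exponents, with the index range -n..n moved to 0..2n; the difference is taken
  in \<open>int\<close> since k may be below n.\<close>

abbreviation sqdist :: "nat \<Rightarrow> nat \<Rightarrow> nat" where
  "sqdist k n \<equiv> nat ((int k - int n)\<^sup>2)"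

lemma prod_lessThan_add:
  fixes f :: "nat \<Rightarrow> 'a::comm_monoid_mult"
  shows "(\<Prod>i<a + b. f i) = (\<Prod>i<a. f i) * (\<Prod>i<b. f (a + i))"
  by (induction b) (simp_all add: mult_ac)

text \<open>Apply the q-binomial theorem with 2n factors, x = z and y = X^(2n-1). Pulling X^(2i) z
  out of the first n factors, read in reverse, and X^(2n-1) out of the others turns each half into
  \<open>D\<close>. Completing the square splits every exponent on the right into \<open>e\<close>
  plus (k - n)^2, and X^e cancels. Since z is its own inverse, z^n can be moved across.\<close>

theorem finite_triple_product:
  assumes "z * z = 1"
  shows "(\<Prod>i<n. 1 + z * fps_X ^ Suc (2 * i))\<^sup>2 =
           (\<Sum>k\<le>2 * n. z ^ (n + k) * (fps_X ^ sqdist k n * qbin (2 * n) k))"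
proof (cases "n = 0")
  case False
  let ?X = "fps_X :: real fps"
  define D where "D = (\<Prod>i<n. 1 + z * ?X ^ Suc (2 * i))"
  define e where "e = n * (n - 1) + (2 * n - 1) * n"
  have zn: "z ^ n * z ^ n = 1"
    using assms by (simp flip: power_mult_distrib)
  have "(\<Prod>i<2 * n. ?X ^ (2 * n - 1) + z * ?X ^ (2 * i)) =
      (\<Prod>i<n. ?X ^ (2 * n - 1) + z * ?X ^ (2 * i)) * (\<Prod>i<n. ?X ^ (2 * n - 1) + z * ?X ^ (2 * (n + i)))"
    by (simp only: mult_2[of n] prod_lessThan_add)
  also have "(\<Prod>i<n. ?X ^ (2 * n - 1) + z * ?X ^ (2 * i)) =
     (\<Prod>i<n. ?X ^ (2 * i) * z * (1 + z * ?X ^ Suc (2 * (n - Suc i))))"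
  proof (rule prod.cong[OF refl])
    fix i assume "i \<in> {..<n}"
    then have "2 * n - 1 = 2 * i + Suc (2 * (n - Suc i))" by auto
    then have "?X ^ (2 * n - 1) = ?X ^ (2 * i) * ?X ^ Suc (2 * (n - Suc i))"
      by (simp only: power_add)
    then show "?X ^ (2 * n - 1) + z * ?X ^ (2 * i) = ?X ^ (2 * i) * z * (1 + z * ?X ^ Suc (2 * (n - Suc i)))"
      using assms by (simp add: algebra_simps del: power_Suc)
  qed
  also have "\<dots> = ?X ^ (n * (n - 1)) * z ^ n * D"
  proof -
    have "(\<Sum>i<m. 2 * i) = m * (m - 1)" for m :: nat
    proof (induction m)
      case (Suc m)
      then show ?case by (cases m) (simp_all add: algebra_simps)
    qed simp
    then have "(\<Prod>i<n. ?X ^ (2 * i)) = ?X ^ (n * (n - 1))"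
      by (simp flip: power_sum)
    moreover have "(\<Prod>i<n. 1 + z * ?X ^ Suc (2 * (n - Suc i))) = D"
      unfolding D_def by (rule prod.nat_diff_reindex)
    ultimately show ?thesis by (simp add: prod.distrib del: power_Suc)
  qed
  also have "(\<Prod>i<n. ?X ^ (2 * n - 1) + z * ?X ^ (2 * (n + i))) =
      (\<Prod>i<n. ?X ^ (2 * n - 1) * (1 + z * ?X ^ Suc (2 * i)))"
  proof (rule prod.cong[OF refl])
    fix i
    have "2 * (n + i) = 2 * n - 1 + Suc (2 * i)" using False by simp
    then have "?X ^ (2 * (n + i)) = ?X ^ (2 * n - 1) * ?X ^ Suc (2 * i)"
      by (simp only: power_add)
    then show "?X ^ (2 * n - 1) + z * ?X ^ (2 * (n + i)) = ?X ^ (2 * n - 1) * (1 + z * ?X ^ Suc (2 * i))"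
      by (simp add: algebra_simps del: power_Suc)
  qed
  also have "\<dots> = ?X ^ ((2 * n - 1) * n) * D"
    by (simp add: prod.distrib D_def power_mult del: power_Suc)
  also have "?X ^ (n * (n - 1)) * z ^ n * D * (?X ^ ((2 * n - 1) * n) * D) = ?X ^ e * (z ^ n * D\<^sup>2)"
    by (simp only: e_def power_add power2_eq_square mult_ac)
  finally have "?X ^ e * (z ^ n * D\<^sup>2) =
      (\<Sum>k\<le>2 * n. ?X ^ (k * (k - 1)) * qbin (2 * n) k * z ^ k * (?X ^ (2 * n - 1)) ^ (2 * n - k))"
    by (simp only: q_binomial_theorem)
  also have "\<dots> = (\<Sum>k\<le>2 * n. ?X ^ e * (z ^ k * (?X ^ sqdist k n * qbin (2 * n) k)))"
  proof (rule sum.cong[OF refl])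
    fix k assume k: "k \<in> {..2 * n}"
    have sub: "int (j * (j - 1)) = int j * (int j - 1)" for j by (cases j) (auto simp: algebra_simps)
    have n2: "int (2 * n - 1) = 2 * int n - 1" using False by simp
    have "int (k * (k - 1) + (2 * n - 1) * (2 * n - k)) =
        int k * (int k - 1) + (2 * int n - 1) * (2 * int n - int k)"
      using k by (simp only: of_nat_add sub) (simp only: of_nat_mult n2 of_nat_diff atMost_iff of_nat_numeral)
    also have "\<dots> = int n * (int n - 1) + (2 * int n - 1) * int n + (int k - int n)\<^sup>2"
      by (simp add: algebra_simps power2_eq_square)
    also have "\<dots> = int (e + sqdist k n)"
      by (simp only: of_nat_add sub e_def) (simp only: of_nat_mult n2, simp)
    finally have "int (k * (k - 1) + (2 * n - 1) * (2 * n - k)) = int (e + sqdist k n)" .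
    then have "k * (k - 1) + (2 * n - 1) * (2 * n - k) = e + sqdist k n"
      by (simp only: of_nat_eq_iff)
    then have "?X ^ (k * (k - 1)) * (?X ^ (2 * n - 1)) ^ (2 * n - k) = ?X ^ e * ?X ^ sqdist k n"
      by (simp only: flip: power_add power_mult)
    then have "(?X ^ (k * (k - 1)) * (?X ^ (2 * n - 1)) ^ (2 * n - k)) * (z ^ k * qbin (2 * n) k) =
        (?X ^ e * ?X ^ sqdist k n) * (z ^ k * qbin (2 * n) k)"
      by (rule arg_cong)
    then show "?X ^ (k * (k - 1)) * qbin (2 * n) k * z ^ k * (?X ^ (2 * n - 1)) ^ (2 * n - k) =
        ?X ^ e * (z ^ k * (?X ^ sqdist k n * qbin (2 * n) k))"
      by (simp only: mult_ac)
  qed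
  finally have "?X ^ e * (z ^ n * D\<^sup>2) = ?X ^ e * (\<Sum>k\<le>2 * n. z ^ k * (?X ^ sqdist k n * qbin (2 * n) k))"
    by (simp add: sum_distrib_left)
  then have "z ^ n * D\<^sup>2 = (\<Sum>k\<le>2 * n. z ^ k * (?X ^ sqdist k n * qbin (2 * n) k))"
    by simp
  then have "z ^ n * (z ^ n * D\<^sup>2) = (\<Sum>k\<le>2 * n. z ^ (n + k) * (?X ^ sqdist k n * qbin (2 * n) k))"
    by (simp add: sum_distrib_left power_add mult.assoc)
  then show ?thesis
    by (simp add: D_def zn flip: mult.assoc)
qed simp

section \<open>Gaussian binomial coefficients: product formula and coefficient bounds\<close>

definition qpoch2 :: "nat \<Rightarrow> real fps" where
  "qpoch2 n = (\<Prod>i=1..n. 1 - fps_X ^ (2 * i))"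

lemma qpoch2_0 [simp]: "qpoch2 0 = 1"
  by (simp add: qpoch2_def)

lemma qpoch2_Suc: "qpoch2 (Suc n) = qpoch2 n * (1 - fps_X ^ (2 * Suc n))"
  by (simp add: qpoch2_def)

lemma qpoch2_nth_0 [simp]: "qpoch2 n $ 0 = 1"
  by (simp add: qpoch2_def prod_nth_0)

text \<open>The quotient formula without division. The double induction follows the recurrence of
  \<open>qbin\<close> and closes by (1 - y) + y(1 - x) = 1 - xy.\<close>

lemma qbin_mult_qpoch2: "qbin (a + b) a * (qpoch2 a * qpoch2 b) = qpoch2 (a + b)"
proof (induction a arbitrary: b)
  case (Suc a)
  note outer = Suc
  have diag: "qbin n n = 1" for n by (induction n) (auto simp: qbin_eq_0)
  show ?case
  proof (induction b)
    case (Suc b)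
    let ?x = "fps_X ^ (2 * Suc a) :: real fps" and ?y = "fps_X ^ (2 * Suc b) :: real fps"
    let ?P = "qpoch2 (Suc (a + b))"
    have key: "(u + y * v) * (c * (1 - x) * (d * (1 - y))) =
        (1 - y) * (u * (c * (1 - x) * d)) + y * (1 - x) * (v * (c * (d * (1 - y))))"
      for c d u v x y :: "real fps" by (simp add: algebra_simps)
    have "qbin (Suc a + Suc b) (Suc a) = qbin (Suc a + b) (Suc a) + ?y * qbin (a + Suc b) a"
      by simp
    then have "qbin (Suc a + Suc b) (Suc a) * (qpoch2 (Suc a) * qpoch2 (Suc b)) =
        (1 - ?y) * (qbin (Suc a + b) (Suc a) * (qpoch2 (Suc a) * qpoch2 b)) +
        ?y * (1 - ?x) * (qbin (a + Suc b) a * (qpoch2 a * qpoch2 (Suc b)))"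
      by (simp only: qpoch2_Suc key)
    also have "\<dots> = (1 - ?y) * ?P + ?y * (1 - ?x) * ?P"
      using Suc outer[of "Suc b"] by simp
    also have "\<dots> = ?P * (1 - ?x * ?y)" by algebra
    also have "\<dots> = qpoch2 (Suc a + Suc b)"
      by (simp add: qpoch2_Suc[of "Suc (a + b)"] mult_ac flip: power_add)
    finally show ?case .
  qed (simp add: diag)
qed simp

definition part2_gf :: "nat \<Rightarrow> real fps" where
  "part2_gf n = (\<Prod>i=1..n. inverse (1 - fps_X ^ (2 * i)))"

lemma part2_gf_nth:
  "part2_gf n $ m = real (card (bounded_msets ((*) 2 ` {1..n}) m))"
proof -
  have "part2_gf n = (\<Prod>i\<in>(*) 2 ` {1..n}. inverse (1 - fps_const 1 * fps_X ^ i))"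
    by (simp add: part2_gf_def prod.reindex inj_on_def)
  then show ?thesis
    by (simp only:) (subst weighted_partition_gf, auto)
qed

text \<open>All parts counted on the left are even, so halving them is injective; for odd m there
  are no such multisets.\<close>

lemma part2_gf_nth_le: "part2_gf n $ m \<le> real (p (m div 2))"
proof -
  let ?B = "bounded_msets ((*) 2 ` {1..n}) m"
  have *: "image_mset ((*) 2) (image_mset (\<lambda>x. x div 2) L) = L" if "L \<in> ?B" for L
  proof -
    have "image_mset (\<lambda>x. 2 * (x div 2)) L = image_mset (\<lambda>x. x) L"
      by (rule image_mset_cong) (use that in \<open>auto simp: bounded_msets_def\<close>)
    then show ?thesis by (simp add: multiset.map_comp o_def)
  qed
  have "card ?B \<le> card (partitions (m div 2))"
  proof (rule card_inj_on_le)
    show "inj_on (image_mset (\<lambda>x. x div 2)) ?B"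
      by (rule inj_on_inverseI) (rule *)
    show "image_mset (\<lambda>x. x div 2) ` ?B \<subseteq> partitions (m div 2)"
    proof safe
      fix L assume L: "L \<in> ?B"
      have "m = sum_mset (image_mset ((*) 2) (image_mset (\<lambda>x. x div 2) L))"
        unfolding *[OF L] using L by (simp add: bounded_msets_def)
      also have "\<dots> = 2 * sum_mset (image_mset (\<lambda>x. x div 2) L)"
        by (simp add: sum_mset_distrib_left multiset.map_comp o_def)
      finally show "image_mset (\<lambda>x. x div 2) L \<in> partitions (m div 2)"
        using L by (auto simp: partitions_def bounded_msets_def)
    qed
  qed (rule finite_partitions)
  then show ?thesis by (simp add: part2_gf_nth p_def)
qed

text \<open>The coefficients of \<open>qbin (a + b) a\<close> count partitions into at most a even
  parts, each at most 2b; dropping the bound on the number of parts gives \<open>part2_gf b\<close>.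
  Formally, P_(b+1) = P_b + X^(2b+2) P_(b+1) for P = \<open>part2_gf\<close> dominates the
  recurrence of \<open>qbin\<close>.\<close>

lemma qbin_nth_bounds: "0 \<le> qbin (a + b) a $ m \<and> qbin (a + b) a $ m \<le> part2_gf b $ m"
proof (induction a arbitrary: b m)
  case 0
  show ?case
  proof (cases "m = 0")
    case True
    then show ?thesis by (simp add: part2_gf_def prod_nth_0)
  qed (simp add: part2_gf_nth)
next
  case (Suc a)
  note outer = Suc
  have diag: "qbin n n = 1" for n by (induction n) (auto simp: qbin_eq_0)
  show ?case
  proof (induction b arbitrary: m)
    case (Suc b)
    let ?y = "fps_X ^ (2 * Suc b) :: real fps"
    have "part2_gf (Suc b) * (1 - ?y) = part2_gf b * (inverse (1 - ?y) * (1 - ?y))"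
      by (simp add: part2_gf_def mult.assoc del: power_Suc)
    also have "inverse (1 - ?y) * (1 - ?y) = 1"
      by (rule inverse_mult_eq_1) simp
    finally have "part2_gf (Suc b) = part2_gf b + ?y * part2_gf (Suc b)"
      by (simp add: algebra_simps)
    moreover have "qbin (Suc a + Suc b) (Suc a) = qbin (Suc a + b) (Suc a) + ?y * qbin (a + Suc b) a"
      by simp
    moreover have "0 \<le> (?y * qbin (a + Suc b) a) $ m \<and> (?y * qbin (a + Suc b) a) $ m \<le> (?y * part2_gf (Suc b)) $ m"
      using outer[of "Suc b" "m - 2 * Suc b"] by (simp only: fps_X_power_mult_nth) auto
    ultimately show ?case
      using Suc[of m] by (metis add_mono add_nonneg_nonneg fps_add_nth)
  qed (auto simp: diag part2_gf_def)
qed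

lemma p_mono: "m \<le> n \<Longrightarrow> p m \<le> p n"
  unfolding p_def
  by (rule card_inj_on_le[of "\<lambda>L. L + replicate_mset (n - m) 1"])
     (auto simp: inj_on_def partitions_def split: if_splits
       intro: finite_partitions[unfolded partitions_def])

lemma qbin_nth_le:
  assumes "k \<le> 2 * n" "j \<le> 2 * m"
  shows "0 \<le> qbin (2 * n) k $ j" "qbin (2 * n) k $ j \<le> real (p m)"
proof -
  have "qbin (2 * n) k $ j \<le> part2_gf (2 * n - k) $ j" "0 \<le> qbin (2 * n) k $ j"
    using qbin_nth_bounds[of k "2 * n - k" j] assms by auto
  moreover have "p (j div 2) \<le> p m" using assms by (intro p_mono) auto
  ultimately show "0 \<le> qbin (2 * n) k $ j" "qbin (2 * n) k $ j \<le> real (p m)"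
    using part2_gf_nth_le[of "2 * n - k" j] by linarith+
qed

lemma card_sqdist_le: "real (card {k. k \<le> l \<and> sqdist k n \<le> y}) \<le> 2 * sqrt (real y) + 1"
proof -
  define s where "s = \<lfloor>sqrt (real y)\<rfloor>"
  have "s \<ge> 0" by (simp add: s_def)
  have "card {k. k \<le> l \<and> sqdist k n \<le> y} \<le> card {-s..s}"
  proof (rule card_inj_on_le)
    show "inj_on (\<lambda>k. int k - int n) {k. k \<le> l \<and> sqdist k n \<le> y}"
      by (auto simp: inj_on_def)
    show "(\<lambda>k. int k - int n) ` {k. k \<le> l \<and> sqdist k n \<le> y} \<subseteq> {-s..s}"
    proof safe
      fix k assume "sqdist k n \<le> y"
      then have "(int k - int n)\<^sup>2 \<le> int y" by linarith
      then have "real_of_int ((int k - int n)\<^sup>2) \<le> real y" by linarith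
      then have "\<bar>real_of_int (int k - int n)\<bar> \<le> sqrt (real y)"
        by (intro real_le_rsqrt) simp
      then have "\<bar>int k - int n\<bar> \<le> s" unfolding s_def by linarith
      then show "int k - int n \<in> {-s..s}" by auto
    qed
  qed simp
  also have "real \<dots> = 2 * s + 1" using \<open>s \<ge> 0\<close> by simp
  also have "\<dots> \<le> 2 * sqrt (real y) + 1" unfolding s_def by linarith
  finally show ?thesis by linarith
qed

subsection \<open>Distinct odd parts and the theta function\<close>

text \<open>A truncation of (-q; q^2): its coefficients up to degree 2n count partitions into
  distinct odd parts.\<close>

definition odd_gf :: "nat \<Rightarrow> real fps" where
  "odd_gf n = (\<Prod>i<n. 1 + fps_X ^ Suc (2 * i))"

definition odd_gf_neg :: "nat \<Rightarrow> real fps" where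
  "odd_gf_neg n = (\<Prod>i<n. 1 - fps_X ^ Suc (2 * i))"

lemma abs_odd_gf_neg_nth_le: "\<bar>odd_gf_neg n $ m\<bar> \<le> odd_gf n $ m"
proof (induction n arbitrary: m)
  case (Suc n)
  let ?y = "fps_X ^ Suc (2 * n) :: real fps"
  have "odd_gf_neg (Suc n) = odd_gf_neg n - ?y * odd_gf_neg n"
    "odd_gf (Suc n) = odd_gf n + ?y * odd_gf n"
    by (simp_all add: odd_gf_def odd_gf_neg_def algebra_simps)
  moreover have "\<bar>(?y * odd_gf_neg n) $ m\<bar> \<le> (?y * odd_gf n) $ m"
    using Suc[of "m - Suc (2 * n)"] by (simp only: fps_X_power_mult_nth) simp
  ultimately show ?case using Suc[of m] by simp
qed (simp add: odd_gf_def odd_gf_neg_def)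

lemma odd_gf_nth_nonneg: "odd_gf n $ m \<ge> 0"
  using abs_odd_gf_neg_nth_le[of n m] by linarith

text \<open>The square is one of the nonnegative terms in the coefficient of X^(2m) of
  \<open>(odd_gf n)\<^sup>2\<close>. The triple product with z = 1 writes that coefficient as a sum
  over the k with (k - n)^2 at most 2m, each term being at most p(m).\<close>

lemma odd_gf_nth_square_le:
  assumes "m \<le> n"
  shows "(odd_gf n $ m)\<^sup>2 \<le> (2 * sqrt (2 * real m) + 1) * real (p m)"
proof -
  let ?K = "{k. k \<le> 2 * n \<and> sqdist k n \<le> 2 * m}"
  have "(odd_gf n $ m)\<^sup>2 = (\<Sum>i\<in>{m}. odd_gf n $ i * odd_gf n $ (2 * m - i))"
    by (simp add: power2_eq_square mult_2)
  also have "\<dots> \<le> (\<Sum>i=0..2*m. odd_gf n $ i * odd_gf n $ (2 * m - i))"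
    by (rule sum_mono2) (auto intro: mult_nonneg_nonneg odd_gf_nth_nonneg)
  also have "\<dots> = ((odd_gf n)\<^sup>2) $ (2 * m)"
    by (simp add: power2_eq_square fps_mult_nth)
  also have "(odd_gf n)\<^sup>2 = (\<Sum>k\<le>2 * n. fps_X ^ sqdist k n * qbin (2 * n) k)"
    using finite_triple_product[of 1 n] by (simp add: odd_gf_def)
  also have "\<dots> $ (2 * m) = (\<Sum>k\<le>2 * n. if 2 * m < sqdist k n then 0 else qbin (2 * n) k $ (2 * m - sqdist k n))"
    by (simp only: fps_sum_nth fps_X_power_mult_nth)
  also have "\<dots> = (\<Sum>k\<in>?K. qbin (2 * n) k $ (2 * m - sqdist k n))"
    by (rule sum.mono_neutral_cong_right) auto
  also have "\<dots> \<le> (\<Sum>k\<in>?K. real (p m))"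
    by (intro sum_mono qbin_nth_le) auto
  also have "\<dots> = real (card ?K) * real (p m)" by simp
  also have "\<dots> \<le> (2 * sqrt (real (2 * m)) + 1) * real (p m)"
    by (intro mult_right_mono card_sqdist_le) simp
  finally show ?thesis by simp
qed

text \<open>The finite source of Euler's identity: split the factors of (q)_(2n) by parity of the
  exponent, then factor each 1 - q^(2i).\<close>

lemma qpoch_factor:
  "qpoch 1 (2 * n) = odd_gf_neg n * qpoch2 n" "qpoch2 n = qpoch 1 n * qpoch (-1) n"
proof -
  show "qpoch 1 (2 * n) = odd_gf_neg n * qpoch2 n"
    by (induction n) (simp_all add: qpoch_Suc qpoch2_Suc odd_gf_neg_def mult_ac)
  have "1 - fps_X ^ (2 * k) = (1 - fps_X ^ k) * (1 + fps_X ^ k :: real fps)" for k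
    by (simp only: mult_2 power_add) (simp add: algebra_simps)
  then show "qpoch2 n = qpoch 1 n * qpoch (-1) n"
    unfolding qpoch2_def qpoch_def by (simp add: prod.distrib flip: fps_const_neg)
qed

lemma qpoch2_cong:
  assumes "m \<le> n" "d \<le> 2 * m + 1"
  shows "fps_cong d (qpoch2 n) (qpoch2 m)"
  unfolding qpoch2_def by (rule fps_cong_prod_extend) (use assms in \<open>auto simp: fps_cong_def\<close>)

text \<open>Gauss's identity \<open>(q)\<^sub>\<infinity> / (-q)\<^sub>\<infinity> = \<Sum>\<^sub>k (-1)\<^sup>k q\<^bsup>k\<^sup>2\<^esup>\<close>, truncated.\<close>

lemma gauss_theta:
  "fps_cong n ((odd_gf_neg n)\<^sup>2 * qpoch2 n) (\<Sum>k\<le>2 * n. (-1) ^ (n + k) * fps_X ^ sqdist k n)"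
proof -
  let ?B = "qpoch2 n"
  \<comment> \<open>The left side stands for (q)/(-q), because (q; q^2)(q^2; q^2) = (q) and (q; q^2)
    = 1/(-q). It is expanded by the triple product with z = -1.\<close>
  have "(odd_gf_neg n)\<^sup>2 * ?B = (\<Sum>k\<le>2 * n. (-1) ^ (n + k) * (fps_X ^ sqdist k n * (qbin (2 * n) k * ?B)))"
    using finite_triple_product[of "-1" n] by (simp add: odd_gf_neg_def sum_distrib_right mult.assoc)
  also have "fps_cong n \<dots> (\<Sum>k\<le>2 * n. (-1) ^ (n + k) * (fps_X ^ sqdist k n * 1))"
  proof (rule fps_cong_sum, rule fps_cong_mult[OF fps_cong_refl])
    fix k assume k: "k \<in> {..2 * n}"
    define l where "l = 2 * n - k"
    define j where "j = min k l"
    \<comment> \<open>Beyond index j, the next factor of \<open>qpoch2\<close> is 1 - X^(2j+2), so d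
      = 2j + 1 is the degree up to which all the products compared below agree.\<close>
    define d where "d = 2 * j + 1"
    have B: "fps_cong d (qpoch2 i) ?B" if "j \<le> i" for i
    proof (rule fps_cong_trans)
      show "fps_cong d (qpoch2 i) (qpoch2 j)"
        using that by (intro qpoch2_cong) (simp_all add: d_def)
      have "j \<le> n" using k by (auto simp: j_def l_def)
      then show "fps_cong d (qpoch2 j) ?B"
        by (intro fps_cong_sym[OF qpoch2_cong]) (simp_all add: d_def)
    qed
    have "fps_cong d (?B * (qbin (2 * n) k * ?B)) (qbin (2 * n) k * (qpoch2 k * qpoch2 l))"
      by (subst mult.left_commute) (intro fps_cong_mult fps_cong_refl fps_cong_sym[OF B], auto simp: j_def)
    also have "qbin (2 * n) k * (qpoch2 k * qpoch2 l) = qpoch2 (2 * n)"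
      using qbin_mult_qpoch2[of k l] k by (simp add: l_def)
    also have "fps_cong d (qpoch2 (2 * n)) (?B * 1)"
      using B[of "2 * n"] by (simp add: j_def l_def)
    finally have "fps_cong d (qbin (2 * n) k * ?B) 1"
      by (rule fps_cong_mult_cancel) simp
    then have "fps_cong (d + sqdist k n) (fps_X ^ sqdist k n * (qbin (2 * n) k * ?B)) (fps_X ^ sqdist k n * 1)"
      by (rule fps_cong_X_power_mult)
    \<comment> \<open>With t = n - j, the distance of k from n, the bound is d + t^2 = 2n + (t -
      1)^2, so precision lost near the ends of the range is regained from the power of X.\<close>
    moreover have "n \<le> d + sqdist k n"
    proof -
      define t where "t = int n - int j"
      have "(int k - int n)\<^sup>2 = t\<^sup>2"
      proof (cases "k \<le> n")
        case True
        then have "int k - int n = - t" using k by (simp add: t_def j_def l_def)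
        then show ?thesis by simp
      next
        case False
        then have "int k - int n = t" using k by (auto simp: t_def j_def l_def of_nat_diff)
        then show ?thesis by simp
      qed
      moreover have "(t - 1)\<^sup>2 \<ge> 0" by simp
      then have "t\<^sup>2 \<ge> 2 * t - 1" by (simp add: power2_eq_square algebra_simps)
      moreover have "int j \<le> int n" using k by (auto simp: j_def l_def)
      ultimately show ?thesis by (simp add: d_def t_def) 
    qed
    ultimately show "fps_cong n (fps_X ^ sqdist k n * (qbin (2 * n) k * ?B)) (fps_X ^ sqdist k n * 1)"
      by (rule fps_cong_mono)
  qed
  finally show ?thesis by simp
qed

theorem abs_sum_crank_sign_le:
  assumes "n \<ge> 2"
  shows "\<bar>\<Sum>L\<in>partitions n. crank_sign L\<bar> \<le>
     (2 * sqrt (real n) + 1) * sqrt ((2 * sqrt (2 * real n) + 1) * real (p n))"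
proof -
  let ?K = "{k. k \<le> 2 * n \<and> sqdist k n \<le> n}"
  define O' where "O' = odd_gf_neg n"
  define q1 where "q1 = qpoch 1 n"
  define q2 where "q2 = qpoch (-1) n"
  have "fps_cong n (qpoch 1 (2 * n)) q1"
    unfolding q1_def qpoch_def by (rule fps_cong_prod_extend) (auto simp: fps_cong_def)
  then have q1: "fps_cong n (O' * qpoch2 n) q1"
    by (simp add: qpoch_factor(1) O'_def)
  \<comment> \<open>As \<open>qpoch2 n\<close> is \<open>q1 * q2\<close>, cancelling
    \<open>q1\<close> yields Euler's identity 1/(-q) = (q; q^2) up to order n.\<close>
  then have "fps_cong n (q1 * (O' * q2)) (q1 * 1)"
    by (simp add: qpoch_factor(2) q1_def q2_def mult_ac)
  then have "fps_cong n (O' * q2) 1"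
    by (rule fps_cong_mult_cancel) (simp add: q1_def)
  then have "fps_cong n (q2 * O') (q2 * inverse q2)"
    by (simp add: q2_def inverse_mult_eq_1' mult.commute)
  then have q2: "fps_cong n (inverse q2) O'"
    using fps_cong_mult_cancel[of n q2 O' "inverse q2"] by (simp add: fps_cong_sym q2_def)
  \<comment> \<open>One copy of \<open>O'\<close> is set aside; the other two, with
    \<open>qpoch2 n\<close>, form the theta series.\<close>
  have "fps_cong n (q1 * inverse q2 ^ 2) ((O' * qpoch2 n) * (O' * O'))"
    unfolding power2_eq_square by (intro fps_cong_mult q2 fps_cong_sym[OF q1])
  also have "\<dots> = O' * (O'\<^sup>2 * qpoch2 n)"
    by (simp add: power2_eq_square mult_ac)
  also have "fps_cong n \<dots> (O' * (\<Sum>k\<le>2 * n. (-1) ^ (n + k) * fps_X ^ sqdist k n))"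
    unfolding O'_def by (intro fps_cong_mult fps_cong_refl gauss_theta)
  also have "\<dots> = (\<Sum>k\<le>2 * n. fps_const ((-1) ^ (n + k)) * (fps_X ^ sqdist k n * O'))"
    by (simp only: sum_distrib_left fps_const_minus_one_power mult_ac)
  finally have "(q1 * inverse q2 ^ 2) $ n =
      (\<Sum>k\<le>2 * n. (-1) ^ (n + k) * (fps_X ^ sqdist k n * O') $ n)"
    by (subst fps_congD[of n]) (auto simp: fps_sum_nth)
  then have "\<bar>\<Sum>L\<in>partitions n. crank_sign L\<bar> = \<bar>\<Sum>k\<le>2 * n. (-1) ^ (n + k) * (fps_X ^ sqdist k n * O') $ n\<bar>"
    using crank_parity_gf[OF assms] by (simp add: q1_def q2_def)
  also have "\<dots> \<le> (\<Sum>k\<le>2 * n. \<bar>(fps_X ^ sqdist k n * O') $ n\<bar>)"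
    by (rule order.trans[OF sum_abs]) (simp add: abs_mult)
  also have "\<dots> = (\<Sum>k\<in>?K. \<bar>O' $ (n - sqdist k n)\<bar>)"
    by (rule sum.mono_neutral_cong_right) (auto simp: fps_X_power_mult_nth)
  also have "\<dots> \<le> (\<Sum>k\<in>?K. sqrt ((2 * sqrt (2 * real n) + 1) * real (p n)))"
  proof (rule sum_mono)
    fix k
    let ?m = "n - sqdist k n"
    have "\<bar>O' $ ?m\<bar> \<le> odd_gf n $ ?m"
      unfolding O'_def by (rule abs_odd_gf_neg_nth_le)
    also have "\<dots> \<le> sqrt ((2 * sqrt (2 * real ?m) + 1) * real (p ?m))"
      by (intro real_le_rsqrt odd_gf_nth_square_le) simp
    also have "\<dots> \<le> sqrt ((2 * sqrt (2 * real n) + 1) * real (p n))"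
      by (intro real_sqrt_le_mono mult_mono) (auto intro: p_mono)
    finally show "\<bar>O' $ ?m\<bar> \<le> sqrt ((2 * sqrt (2 * real n) + 1) * real (p n))" .
  qed
  also have "\<dots> = real (card ?K) * sqrt ((2 * sqrt (2 * real n) + 1) * real (p n))" by simp
  also have "\<dots> \<le> (2 * sqrt (real n) + 1) * sqrt ((2 * sqrt (2 * real n) + 1) * real (p n))"
    by (intro mult_right_mono card_sqdist_le) simp
  finally show ?thesis .
qed

subsection \<open>The growth of p(n)\<close>

text \<open>The right side is (n + 1)(n + 2)...(n + k).\<close>

lemma power_le_fact_mult_choose: "n ^ k \<le> fact k * ((n + k) choose k)"
proof (induction k)
  case (Suc k)
  have "n ^ Suc k \<le> Suc (n + k) * (fact k * ((n + k) choose k))"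
    unfolding power_Suc by (intro mult_mono Suc) auto
  also have "\<dots> = fact k * (Suc k * (Suc (n + k) choose Suc k))"
    by (simp only: Suc_times_binomial mult_ac)
  finally show ?case by (simp add: algebra_simps)
qed simp

lemma card_permutations_of_multiset_le: "card (permutations_of_multiset A) \<le> fact (size A)"
proof -
  have "card (permutations_of_multiset A) * 1 \<le>
      card (permutations_of_multiset A) * (\<Prod>x\<in>set_mset A. fact (count A x))"
    by (intro mult_left_mono prod_ge_1) (auto simp: Suc_le_eq)
  then show ?thesis by (simp only: card_permutations_of_multiset_aux mult_1_right)
qed

text \<open>A partition with at most \<open>m\<close> parts, padded with zeros, arises from at most \<open>m!\<close>
  weak compositions into \<open>m\<close> parts.\<close>

lemma compositions_le_partitions: "((n + k) choose k) \<le> p n * fact (Suc k)"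
proof -
  define S where "S = {l :: nat list. length l = Suc k \<and> sum_list l = n}"
  define f where "f l = {#x \<in># mset l. x \<noteq> 0#}" for l :: "nat list"
  have fibre: "card {l \<in> S. f l = L} \<le> fact (Suc k)" for L
  proof (cases "{l \<in> S. f l = L} = {}")
    case False
    \<comment> \<open>Every list in a nonempty fibre is an ordering of \<open>L\<close> padded with
      zeros to length k + 1.\<close>
    let ?L = "L + replicate_mset (Suc k - size L) 0"
    have *: "mset l = ?L" "size ?L = Suc k" if l: "l \<in> S" "f l = L" for l
    proof -
      have "mset l = L + replicate_mset (count (mset l) 0) 0"
        using multiset_partition[of "mset l" "\<lambda>x. x \<noteq> 0"] l
        by (simp add: f_def filter_eq_replicate_mset)
      moreover from arg_cong[OF this, of size] have "count (mset l) 0 = Suc k - size L" "size L \<le> Suc k"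
        using l by (auto simp: S_def)
      ultimately show "mset l = ?L" "size ?L = Suc k" by auto
    qed
    have "card {l \<in> S. f l = L} \<le> card (permutations_of_multiset ?L)"
    proof (rule card_mono)
      show "{l \<in> S. f l = L} \<subseteq> permutations_of_multiset ?L"
        using *(1) permutations_of_multisetI by blast
    qed simp
    also have "\<dots> \<le> fact (size ?L)" by (rule card_permutations_of_multiset_le)
    also have "size ?L = Suc k" using False * by blast
    finally show ?thesis .
  qed (simp only: card.empty le0)
  have S: "S = (\<Union>L\<in>partitions n. {l \<in> S. f l = L})"
  proof -
    have "f l \<in> partitions n" if "l \<in> S" for l
    proof -
      have "sum_mset {#x \<in># A. x \<noteq> 0#} = sum_mset A" for A :: "nat multiset"
        by (induction A) auto
      then show ?thesis using that by (simp add: S_def f_def partitions_def sum_mset_sum_list)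
    qed
    then show ?thesis by auto
  qed
  have "card S = card (\<Union>L\<in>partitions n. {l \<in> S. f l = L})"
    by (rule arg_cong[OF S])
  also have "\<dots> \<le> (\<Sum>L\<in>partitions n. card {l \<in> S. f l = L})"
    by (rule card_UN_le[OF finite_partitions])
  also have "\<dots> \<le> (\<Sum>L\<in>partitions n. fact (Suc k))"
    by (intro sum_mono fibre)
  also have "card S = (n + k) choose k"
    using binomial_symmetric[of n "n + k"] by (simp add: S_def card_length_sum_list)
  finally show ?thesis by (simp add: p_def)
qed

text \<open>Compare the sinh series termwise with a multiple of the sum of (k+1)(9/16)^k, using n^k
  <= k! (k+1)! p(n) and 4^k k! (k+1)! <= (k+1) (2k+1)!. A rate r in place of 3/2 gives the ratio
  r^2/4, so r must be below 2; 3/2 exceeds the rate pi sqrt(24)/12, about 1.283, of mu(n)/2.\<close>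

theorem sinh_le_p:
  "sinh (3 / 2 * sqrt (real n)) \<le> 8 * sqrt (real n) * real (p n)"
proof -
  define y where "y = sqrt (real n)"
  define c where "c = 3 / 2 * y * real (p n)"
  have y: "y \<ge> 0" "y\<^sup>2 = real n" by (auto simp: y_def)
  have "(\<lambda>k. if even k then 0 else (3 / 2 * y) ^ k /\<^sub>R fact k) sums sinh (3 / 2 * y)"
    by (rule sinh_converges)
  then have "(\<lambda>k. (3 / 2 * y) ^ (2 * k + 1) / fact (2 * k + 1)) sums sinh (3 / 2 * y)"
    by (subst (asm) sums_mono_reindex[of "\<lambda>k. 2 * k + 1", symmetric])
       (auto simp: strict_mono_def field_simps elim!: oddE)
  moreover have "(\<lambda>k. c * (real (Suc k) * (9 / 16) ^ k)) sums (c * (1 / (1 - 9 / 16)\<^sup>2))"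
    by (intro sums_mult geometric_deriv_sums) simp
  moreover have "(3 / 2 * y) ^ (2 * k + 1) / fact (2 * k + 1) \<le> c * (real (Suc k) * (9 / 16) ^ k)" for k
  proof -
    \<comment> \<open>Halving the central binomial coefficient of 2k + 2 gives binom(2k+1, k) >=
      4^k/(k+1).\<close>
    have "4 ^ Suc k / (2 * real (Suc k)) \<le> real ((2 * Suc k) choose Suc k)"
      by (rule central_binomial_lower_bound) simp
    also have "(2 * Suc k) choose Suc k = 2 * ((2 * k + 1) choose k)"
      using binomial_symmetric[of "Suc k" "2 * k + 1"] by simp
    finally have "4 ^ k \<le> real (Suc k) * real ((2 * k + 1) choose k)"
      by (simp add: field_simps)
    then have "4 ^ k * (fact k * fact (Suc k)) \<le> real (Suc k) * real ((2 * k + 1) choose k) * (fact k * fact (Suc k))"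
      by (rule mult_right_mono) simp
    also have "fact k * fact (Suc k) * ((2 * k + 1) choose k) = (fact (2 * k + 1) :: nat)"
      using binomial_fact_lemma[of k "2 * k + 1"] by simp
    then have "real (fact k * fact (Suc k) * ((2 * k + 1) choose k)) = real (fact (2 * k + 1))"
      by (simp only: of_nat_eq_iff)
    then have "real ((2 * k + 1) choose k) * (fact k * fact (Suc k)) = fact (2 * k + 1)"
      by (simp only: of_nat_mult of_nat_fact mult.commute)
    then have "real (Suc k) * real ((2 * k + 1) choose k) * (fact k * fact (Suc k)) = real (Suc k) * fact (2 * k + 1)"
      by (simp only: mult.assoc)
    finally have fact: "4 ^ k * (fact k * fact (Suc k)) \<le> real (Suc k) * fact (2 * k + 1)" .
    have "n ^ k \<le> fact k * (p n * fact (Suc k))"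
      using power_le_fact_mult_choose[of n k] compositions_le_partitions[of n k]
      by (meson mult_left_mono order_trans zero_le)
    then have "real (n ^ k) \<le> real (fact k * (p n * fact (Suc k)))"
      by (simp only: of_nat_le_iff)
    then have "real n ^ k \<le> real (p n) * (fact k * fact (Suc k))"
      by (simp add: mult.left_commute del: fact_Suc)
    then have "4 ^ k * real n ^ k \<le> real (p n) * (4 ^ k * (fact k * fact (Suc k)))"
      by (simp add: mult.left_commute del: fact_Suc)
    also have "\<dots> \<le> real (p n) * (real (Suc k) * fact (2 * k + 1))"
      by (intro mult_left_mono fact) simp
    finally have "3 / 2 * y * (9 / 16) ^ k * (4 ^ k * real n ^ k) \<le>
        3 / 2 * y * (9 / 16) ^ k * (real (p n) * (real (Suc k) * fact (2 * k + 1)))"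
      using y by (intro mult_left_mono) auto
    also have "3 / 2 * y * (9 / 16) ^ k * (4 ^ k * real n ^ k) = 3 / 2 * y * ((9 / 16 * 4 * y\<^sup>2) ^ k)"
      by (simp only: power_mult_distrib y(2) mult.assoc)
    also have "9 / 16 * 4 * y\<^sup>2 = (3 / 2 * y)\<^sup>2" by (simp add: power2_eq_square)
    also have "3 / 2 * y * ((3 / 2 * y)\<^sup>2) ^ k = (3 / 2 * y) ^ (2 * k + 1)"
      by (simp flip: power_mult)
    finally show ?thesis
      by (simp add: c_def divide_le_eq mult_ac del: fact_Suc of_nat_Suc)
  qed
  ultimately have "sinh (3 / 2 * y) \<le> c * (1 / (1 - 9 / 16)\<^sup>2)"
    by (rule sums_le[rotated])
  \<comment> \<open>The constant is 3/2 times (16/7)^2.\<close>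
  also have "\<dots> = 384 / 49 * (y * real (p n))" by (simp add: c_def power2_eq_square)
  also have "\<dots> \<le> 8 * (y * real (p n))"
    using y by (intro mult_right_mono) auto
  finally show ?thesis by (simp add: y_def)
qed

text \<open>For y = sqrt n >= 2 the left side is at most 36 y^3 exp(1.31 y), while p(n) is at least
  exp(1.5 y)/(32 y). The gap 0.19 between the rates absorbs 36 * 32 y^4 = 1152 y^4.\<close>

lemma exp_mu_le:
  assumes "n \<ge> 4"
  shows "(2 * sqrt (real n) + 1)\<^sup>2 * (2 * sqrt (2 * real n) + 1) * exp (mu n / 2) \<le> (2 * 11578)\<^sup>2 * real (p n)"
proof -
  define y where "y = sqrt (real n)"
  have "sqrt 4 \<le> y" unfolding y_def by (intro real_sqrt_le_mono) (use assms in simp)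
  then have y: "y \<ge> 2" by simp
  have "sqrt (24 * real n - 1) \<le> sqrt (24 * real n)" by simp
  also have "\<dots> \<le> 4.9 * y"
    unfolding y_def real_sqrt_mult by (intro mult_right_mono real_le_lsqrt) (auto simp: power2_eq_square)
  finally have "mu n / 2 \<le> 3.2 * (4.9 * y) / 12"
    using pi_approx mult_mono[of pi "3.2" "sqrt (24 * real n - 1)" "4.9 * y"] assms
    by (simp add: mu_def)
  also have "\<dots> \<le> 1.31 * y" using y by simp
  finally have mu: "exp (mu n / 2) \<le> exp (1.31 * y)" by simp
  have "sqrt (2 * real n) \<le> 1.5 * y"
    unfolding y_def real_sqrt_mult by (intro mult_right_mono real_le_lsqrt) (auto simp: power2_eq_square)
  then have s: "2 * sqrt (2 * real n) + 1 \<le> 4 * y" using y by simp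
  let ?l = "(2 * y + 1)\<^sup>2 * (2 * sqrt (2 * real n) + 1) * exp (mu n / 2)"
  have "?l \<le> (3 * y)\<^sup>2 * (4 * y) * exp (1.31 * y)"
    by (intro mult_mono power_mono s mu) (use y in auto)
  then have "32 * ?l * y \<le> 32 * ((3 * y)\<^sup>2 * (4 * y) * exp (1.31 * y)) * y"
    using y by (intro mult_right_mono mult_left_mono) auto
  also have "32 * ((3 * y)\<^sup>2 * (4 * y) * exp (1.31 * y)) * y \<le> (2 * 11578)\<^sup>2 * exp (1.5 * y)"
  proof -
    \<comment> \<open>The rate 0.0475 is 0.19/4, so the fourth power matches y^4; numerically (2 *
      11578)^2 * 0.0475^4 is above 1152.\<close>
    have "0.0475 * y \<le> exp (0.0475 * y)" using exp_ge_add_one_self[of "0.0475 * y"] by linarith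
    then have "(0.0475 * y) ^ 4 \<le> exp (0.0475 * y) ^ 4" using y by (intro power_mono) auto
    also have "\<dots> = exp (0.19 * y)" by (simp flip: exp_of_nat_mult)
    finally have "(2 * 11578)\<^sup>2 * (0.0475 * y) ^ 4 \<le> (2 * 11578)\<^sup>2 * exp (0.19 * y)" by simp
    moreover have "1152 * y ^ 4 \<le> (2 * 11578)\<^sup>2 * (0.0475 * y) ^ 4"
      unfolding power_mult_distrib mult.assoc[symmetric] by (intro mult_right_mono) (simp_all add: power_divide)
    ultimately have "1152 * y ^ 4 \<le> (2 * 11578)\<^sup>2 * exp (0.19 * y)" by linarith
    then have "1152 * y ^ 4 * exp (1.31 * y) \<le> (2 * 11578)\<^sup>2 * exp (0.19 * y) * exp (1.31 * y)"
      by (rule mult_right_mono) simp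
    also have "\<dots> = (2 * 11578)\<^sup>2 * exp (1.5 * y)"
      by (simp add: mult.assoc flip: exp_add)
    finally show ?thesis by (simp add: power2_eq_square power4_eq_xxxx mult_ac)
  qed
  also have "(2 * 11578)\<^sup>2 * exp (1.5 * y) \<le> (2 * 11578)\<^sup>2 * (32 * y * real (p n))"
  proof (intro mult_left_mono)
    show "exp (1.5 * y) \<le> 32 * y * real (p n)"
    proof -
      have "2 \<le> 1 + 1.5 * y" using y by simp
      also have "\<dots> \<le> exp (1.5 * y)" by (rule exp_ge_add_one_self)
      finally have "2 \<le> exp (1.5 * y)" .
      moreover have "exp (- (1.5 * y)) \<le> 1" using y by simp
      moreover have "a \<le> 4 * ((a - b) / 2)" if "2 \<le> a" "b \<le> 1" for a b :: real
        using that by simp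
      ultimately have "exp (1.5 * y) \<le> 4 * sinh (1.5 * y)"
        unfolding sinh_field_def by blast
      also have "\<dots> \<le> 4 * (8 * y * real (p n))"
        using sinh_le_p[of n] by (simp add: y_def mult_ac)
      finally show ?thesis by simp
    qed
  qed simp
  finally have "(32 * y) * ?l \<le> (32 * y) * ((2 * 11578)\<^sup>2 * real (p n))"
    by (simp only: mult_ac)
  then have "?l \<le> (2 * 11578)\<^sup>2 * real (p n)"
    by (rule mult_left_le_imp_le) (use y in simp)
  then show ?thesis by (simp only: y_def)
qed

section \<open>From the sum of signs to the proportions of even and odd cranks\<close>

lemma p_pos: "p n > 0"
proof -
  have "replicate_mset n 1 \<in> partitions n" by (auto simp: partitions_def)
  then show ?thesis unfolding p_def using finite_partitions by (auto simp: card_gt_0_iff)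
qed

lemma M_add: "M 0 n + M 1 n = p n"
proof -
  have "partitions n = {L \<in> partitions n. crank L mod 2 = 0} \<union> {L \<in> partitions n. crank L mod 2 = 1}"
    by auto
  then have "p n = card ({L \<in> partitions n. crank L mod 2 = 0} \<union> {L \<in> partitions n. crank L mod 2 = 1})"
    by (simp add: p_def)
  also have "\<dots> = M 0 n + M 1 n"
    unfolding M_def by (subst card_Un_disjoint) (auto simp: finite_partitions)
  finally show ?thesis ..
qed

lemma M_diff: "real (M 0 n) - real (M 1 n) = (\<Sum>L\<in>partitions n. crank_sign L)"
proof -
  have "(\<Sum>L\<in>partitions n. crank_sign L) =
     (\<Sum>L\<in>partitions n. (if crank L mod 2 = 0 then 1 else 0) - (if crank L mod 2 = 1 then 1 else 0))"
    by (intro sum.cong) (auto simp: crank_sign_def even_iff_mod_2_eq_zero)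
  also have "\<dots> = real (M 0 n) - real (M 1 n)"
    by (simp add: sum_subtractf M_def finite_partitions sum.If_cases Int_def)
  finally show ?thesis ..
qed

theorem theorem2p4:
  "\<exists>E :: nat \<Rightarrow> real. \<forall>n\<ge>4.
     (\<forall>k\<in>{0, 1}. real (M k n) / real (p n) = 1 / 2 + (-1) ^ k * E n) \<and>
     \<bar>E n\<bar> \<le> 11578 * exp (- mu n / 4)"
proof (intro exI allI impI conjI)
  fix n :: nat assume n: "4 \<le> n"
  \<comment> \<open>Since the two counts add up to p(n), this is the only possible error
    term.\<close>
  let ?E = "\<lambda>n. (real (M 0 n) - real (M 1 n)) / (2 * real (p n))"
  have pos: "real (p n) > 0" using p_pos by simp
  have "real (M 0 n) + real (M 1 n) = real (p n)"
    using M_add[of n] by (metis of_nat_add)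
  then show "\<forall>k\<in>{0, 1}. real (M k n) / real (p n) = 1 / 2 + (-1) ^ k * ?E n"
    using pos by (auto simp: field_simps)
  let ?u = "2 * sqrt (real n) + 1" and ?v = "2 * sqrt (2 * real n) + 1"
  have "\<bar>?E n\<bar> = \<bar>\<Sum>L\<in>partitions n. crank_sign L\<bar> / (2 * real (p n))"
    by (simp only: M_diff abs_divide)
  also have "\<dots> \<le> ?u * sqrt (?v * real (p n)) / (2 * real (p n))"
    using abs_sum_crank_sign_le[of n] n pos by (intro divide_right_mono) auto
  also have "\<dots> \<le> 11578 * exp (- mu n / 4)"
  proof -
    \<comment> \<open>Squaring removes the root and turns mu/4 into the mu/2 of
      \<open>exp_mu_le\<close>.\<close>
    have "(?u * sqrt (?v * real (p n)) * exp (mu n / 4))\<^sup>2 = ?u\<^sup>2 * ?v * exp (mu n / 2) * real (p n)"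
      by (simp add: power_mult_distrib flip: exp_of_nat_mult)
    also have "\<dots> \<le> (2 * 11578)\<^sup>2 * real (p n) * real (p n)"
      by (intro mult_right_mono exp_mu_le n) simp
    also have "\<dots> = (2 * 11578 * real (p n))\<^sup>2" by (simp add: power2_eq_square)
    finally have "?u * sqrt (?v * real (p n)) * exp (mu n / 4) \<le> 2 * 11578 * real (p n)"
      by (rule power2_le_imp_le) simp
    then have "?u * sqrt (?v * real (p n)) \<le> 11578 * exp (- (mu n / 4)) * (2 * real (p n))"
      by (simp add: exp_minus field_simps)
    then show ?thesis using pos by (simp add: divide_le_eq)
  qed
  finally show "\<bar>?E n\<bar> \<le> 11578 * exp (- mu n / 4)" .
qed

end
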